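(* Let $\kappa>0$, let $X$ be a complete CAT($\kappa$) space, and let $K$ be a nonempty, closed and convex subset of $X$ with $\operatorname{rad}(K)<\frac{\pi}{2\sqrt{\kappa}}$. Let $T:K\to C(K)$ be an $(a_1,a_2,b_1,b_2)$-multivalued hybrid mapping of type I. Then $F(T)\neq\emptyset$.
   Context: $(X,d)$ is a metric space. A CAT($\kappa$) space ($\kappa>0$) is a metric space in which any two points at distance less than $D_\kappa=\pi/\sqrt{\kappa}$ are joined by a geodesic, and in which every geodesic triangle of perimeter less than $2D_\kappa$ satisfies $d(p,q)\le d(\bar p,\bar q)$ for all points $p,q$ of the triangle and their comparison points $\bar p,\bar q$ in a comparison triangle in the model surface $M_\kappa^2$ (the sphere $S^2$ with its distance multiplied by $1/\sqrt{\kappa}$). A subset is convex if it contains every geodesic segment joining any two of its points. $\operatorname{rad}(K)=\inf_{x\in K}\sup_{y\in K}d(x,y)$. $C(K)$ is the family of nonempty compact subsets of $K$. $F(T)=\{x\in K: x\in Tx\}$. $T$ is an $(a_1,a_2,b_1,b_2)$-multivalued hybrid mapping of type I on $K$ if $a_1,a_2:K\to\mathbb{R}\setminus(0,1)$ and $b_1,b_2:K\to[0,1]$ are functions with $a_1(x)+a_2(x)\ge 1$ and $b_1(x)+b_2(x)\le 1$ for all $x\in K$, and $$a_1(x)d^2(u,v)+a_2(x)d^2(u,y)\le b_1(x)d^2(x,v)+b_2(x)d^2(x,y)$$ for all $x,y\in K$, all $u\in Tx$ and all $v\in Ty$. *)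

theory Defs
  imports "HOL-Analysis.Analysis"
begin

text \<open>
  Geodesics are defined relative to a carrier set and a distance function, because they are
  needed both in the given space and in the model surface, whose (angular) distance is not the
  type-class distance of the ambient Euclidean space.
\<close>

definition geodesic_path :: "'a set \<Rightarrow> ('a \<Rightarrow> 'a \<Rightarrow> real) \<Rightarrow> real \<Rightarrow> (real \<Rightarrow> 'a) \<Rightarrow> bool" where
  "geodesic_path S d l c \<longleftrightarrow>
     0 \<le> l \<and> c \<in> {0..l} \<rightarrow> S \<and> (\<forall>s\<in>{0..l}. \<forall>t\<in>{0..l}. d (c s) (c t) = \<bar>s - t\<bar>)"

definition geodesic_segment :: "'a set \<Rightarrow> ('a \<Rightarrow> 'a \<Rightarrow> real) \<Rightarrow> 'a \<Rightarrow> 'a \<Rightarrow> 'a set \<Rightarrow> bool" where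
  "geodesic_segment S d x y G \<longleftrightarrow>
     (\<exists>l c. geodesic_path S d l c \<and> c 0 = x \<and> c l = y \<and> G = c ` {0..l})"

definition geodesic_triangle ::
    "'a set \<Rightarrow> ('a \<Rightarrow> 'a \<Rightarrow> real) \<Rightarrow> 'a \<Rightarrow> 'a \<Rightarrow> 'a \<Rightarrow> 'a set \<Rightarrow> 'a set \<Rightarrow> 'a set \<Rightarrow> bool" where
  "geodesic_triangle S d x y z A B C \<longleftrightarrow>
     geodesic_segment S d x y A \<and> geodesic_segment S d y z B \<and> geodesic_segment S d z x C"

definition geodesically_convex :: "'a set \<Rightarrow> ('a \<Rightarrow> 'a \<Rightarrow> real) \<Rightarrow> 'a set \<Rightarrow> bool" where
  "geodesically_convex S d K \<longleftrightarrow>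
     K \<subseteq> S \<and> (\<forall>x\<in>K. \<forall>y\<in>K. \<forall>G. geodesic_segment S d x y G \<longrightarrow> G \<subseteq> K)"

definition model_surface :: "(real ^ 3) set" where
  "model_surface = sphere 0 1"

definition model_dist :: "real \<Rightarrow> real ^ 3 \<Rightarrow> real ^ 3 \<Rightarrow> real" where
  "model_dist \<kappa> u v = arccos (u \<bullet> v) / sqrt \<kappa>"

definition model_diameter :: "real \<Rightarrow> real" where
  "model_diameter \<kappa> = pi / sqrt \<kappa>"

text \<open>
  A comparison triangle is unique up to isometry when the perimeter is less than twice
  the diameter of the model surface, so the inequality is required for all of them.  A point
  lying on several sides of the triangle may have several comparison points.
\<close>

definition comparison_triangle ::
    "real \<Rightarrow> ('a \<Rightarrow> 'a \<Rightarrow> real) \<Rightarrow> 'a \<Rightarrow> 'a \<Rightarrow> 'a \<Rightarrow> real ^ 3 \<Rightarrow> real ^ 3 \<Rightarrow> real ^ 3 \<Rightarrow>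
     (real ^ 3) set \<Rightarrow> (real ^ 3) set \<Rightarrow> (real ^ 3) set \<Rightarrow> bool" where
  "comparison_triangle \<kappa> d x y z x' y' z' A' B' C' \<longleftrightarrow>
     geodesic_triangle model_surface (model_dist \<kappa>) x' y' z' A' B' C' \<and>
     model_dist \<kappa> x' y' = d x y \<and> model_dist \<kappa> y' z' = d y z \<and> model_dist \<kappa> z' x' = d z x"

definition comparison_point ::
    "real \<Rightarrow> ('a \<Rightarrow> 'a \<Rightarrow> real) \<Rightarrow> 'a \<Rightarrow> 'a \<Rightarrow> 'a \<Rightarrow> 'a set \<Rightarrow> 'a set \<Rightarrow> 'a set \<Rightarrow>
     real ^ 3 \<Rightarrow> real ^ 3 \<Rightarrow> real ^ 3 \<Rightarrow> (real ^ 3) set \<Rightarrow> (real ^ 3) set \<Rightarrow> (real ^ 3) set \<Rightarrow>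
     'a \<Rightarrow> real ^ 3 \<Rightarrow> bool" where
  "comparison_point \<kappa> d x y z A B C x' y' z' A' B' C' p p' \<longleftrightarrow>
     (p \<in> A \<and> p' \<in> A' \<and> model_dist \<kappa> x' p' = d x p) \<or>
     (p \<in> B \<and> p' \<in> B' \<and> model_dist \<kappa> y' p' = d y p) \<or>
     (p \<in> C \<and> p' \<in> C' \<and> model_dist \<kappa> z' p' = d z p)"

definition CAT_space :: "real \<Rightarrow> 'a set \<Rightarrow> ('a \<Rightarrow> 'a \<Rightarrow> real) \<Rightarrow> bool" where
  "CAT_space \<kappa> S d \<longleftrightarrow>
     Metric_space S d \<and>
     (\<forall>x\<in>S. \<forall>y\<in>S. d x y < model_diameter \<kappa> \<longrightarrow> (\<exists>G. geodesic_segment S d x y G)) \<and>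
     (\<forall>x y z A B C x' y' z' A' B' C' p q p' q'.
        geodesic_triangle S d x y z A B C \<longrightarrow>
        d x y + d y z + d z x < 2 * model_diameter \<kappa> \<longrightarrow>
        comparison_triangle \<kappa> d x y z x' y' z' A' B' C' \<longrightarrow>
        comparison_point \<kappa> d x y z A B C x' y' z' A' B' C' p p' \<longrightarrow>
        comparison_point \<kappa> d x y z A B C x' y' z' A' B' C' q q' \<longrightarrow>
        d p q \<le> model_dist \<kappa> p' q')"

text \<open>Extended reals, so that an unbounded set has infinite radius.\<close>

definition rad :: "'a::metric_space set \<Rightarrow> ereal" where
  "rad K = (INF x\<in>K. SUP y\<in>K. ereal (dist x y))"

definition compact_subsets :: "'a::metric_space set \<Rightarrow> 'a set set" where
  "compact_subsets K = {A. A \<noteq> {} \<and> compact A \<and> A \<subseteq> K}"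

definition fixed_points :: "'a set \<Rightarrow> ('a \<Rightarrow> 'a set) \<Rightarrow> 'a set" where
  "fixed_points K T = {x \<in> K. x \<in> T x}"

definition multivalued_hybrid_I ::
    "'a::metric_space set \<Rightarrow> ('a \<Rightarrow> 'a set) \<Rightarrow>
     ('a \<Rightarrow> real) \<Rightarrow> ('a \<Rightarrow> real) \<Rightarrow> ('a \<Rightarrow> real) \<Rightarrow> ('a \<Rightarrow> real) \<Rightarrow> bool" where
  "multivalued_hybrid_I K T a1 a2 b1 b2 \<longleftrightarrow>
     a1 \<in> K \<rightarrow> UNIV - {0<..<1} \<and> a2 \<in> K \<rightarrow> UNIV - {0<..<1} \<and>
     b1 \<in> K \<rightarrow> {0..1} \<and> b2 \<in> K \<rightarrow> {0..1} \<and>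
     (\<forall>x\<in>K. a1 x + a2 x \<ge> 1 \<and> b1 x + b2 x \<le> 1) \<and>
     (\<forall>x\<in>K. \<forall>y\<in>K. \<forall>u\<in>T x. \<forall>v\<in>T y.
        a1 x * (dist u v)\<^sup>2 + a2 x * (dist u y)\<^sup>2 \<le> b1 x * (dist x v)\<^sup>2 + b2 x * (dist x y)\<^sup>2)"

end

theory Submission
  imports Defs
begin

text \<open>
  The fixed point is the asymptotic center of an orbit.  Choose any \<open>s\<close> in \<open>K\<close> with
  \<open>s (Suc n) \<in> T (s n)\<close> and let \<open>r x\<close> be the upper limit of \<open>dist x (s n)\<close>.  Since \<open>K\<close> lies in a
  ball of radius less than \<open>pi / (2 * sqrt \<kappa>)\<close> about one of its points, the infimum of \<open>r\<close> over
  \<open>K\<close> is less than this number.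

  Below this threshold balls of a CAT(\<open>\<kappa>\<close>) space are uniformly round: if \<open>y\<close> and \<open>z\<close> both almost
  minimise \<open>r\<close> and are far apart, comparison with the sphere, where the midpoint of two unit
  vectors is their normalised sum, shows that the midpoint of \<open>y\<close> and \<open>z\<close> has a value of \<open>r\<close>
  below the infimum (\<open>CAT_space_midpoint_ineq\<close>, \<open>CAT_space_almost_centers_close\<close>).
  Minimising sequences are therefore Cauchy, so \<open>r\<close> has a unique minimiser \<open>z\<close> in \<open>K\<close>
  (\<open>CAT_space_asymptotic_center\<close>).

  The hybrid inequality at the pair \<open>z\<close>, \<open>s n\<close> gives, for every \<open>u \<in> T z\<close>, in the limit
  \<open>r u \<le> r z\<close> (\<open>hybrid_orbit_asymptotic_radius_le\<close>).  By uniqueness \<open>u = z\<close>, and \<open>T z\<close> is not empty.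
\<close>

section \<open>Geodesics and triangles in the model sphere\<close>

lemma great_arc_inner:
  fixes u w :: "'a::real_inner"
  assumes "norm u = 1" "norm w = 1" "u \<bullet> w = 0"
  shows "(cos a *\<^sub>R u + sin a *\<^sub>R w) \<bullet> (cos b *\<^sub>R u + sin b *\<^sub>R w) = cos (a - b)"
  using assms by (simp add: inner_add_left inner_add_right inner_commute[of w u]
      norm_eq_1 cos_diff)

lemma great_arc_geodesic_path:
  fixes u w :: "real ^ 3"
  assumes \<kappa>: "\<kappa> > 0" and "norm u = 1" "norm w = 1" "u \<bullet> w = 0"
    and l: "0 \<le> l" "sqrt \<kappa> * l \<le> pi"
  shows "geodesic_path model_surface (model_dist \<kappa>) l
           (\<lambda>t. cos (sqrt \<kappa> * t) *\<^sub>R u + sin (sqrt \<kappa> * t) *\<^sub>R w)"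
  unfolding geodesic_path_def
proof (intro conjI ballI)
  let ?c = "\<lambda>t. cos (sqrt \<kappa> * t) *\<^sub>R u + sin (sqrt \<kappa> * t) *\<^sub>R w"
  have k: "sqrt \<kappa> > 0" using \<kappa> by simp
  have inner: "?c s \<bullet> ?c t = cos (sqrt \<kappa> * s - sqrt \<kappa> * t)" for s t
    by (rule great_arc_inner) (use assms in auto)
  show "?c \<in> {0..l} \<rightarrow> model_surface"
    unfolding model_surface_def using inner by (auto simp: norm_eq_1)
  fix s t assume st: "s \<in> {0..l}" "t \<in> {0..l}"
  have "sqrt \<kappa> * \<bar>s - t\<bar> \<le> sqrt \<kappa> * l"
    using st k by (intro mult_left_mono) auto
  then have le: "sqrt \<kappa> * \<bar>s - t\<bar> \<le> pi" using l by linarith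
  have "cos (sqrt \<kappa> * s - sqrt \<kappa> * t) = cos (sqrt \<kappa> * \<bar>s - t\<bar>)"
    by (metis abs_mult abs_of_pos cos_abs_real k right_diff_distrib)
  then show "model_dist \<kappa> (?c s) (?c t) = \<bar>s - t\<bar>"
    unfolding model_dist_def inner using k le by (simp add: arccos_cos)
qed (use l in auto)

lemma unit_vector_in_great_circle:
  fixes u v :: "real ^ 3"
  assumes u: "norm u = 1" and v: "norm v = 1"
  obtains w where "norm w = 1" "u \<bullet> w = 0"
    "v = (u \<bullet> v) *\<^sub>R u + sqrt (1 - (u \<bullet> v)\<^sup>2) *\<^sub>R w"
proof (cases "v = (u \<bullet> v) *\<^sub>R u")
  case True
  obtain y where y: "y \<noteq> 0" "orthogonal u y"
    using orthogonal_to_vector_exists[of u] by auto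
  have "\<bar>u \<bullet> v\<bar> = 1" using True u v by (metis mult.right_neutral norm_scaleR)
  then have "(u \<bullet> v)\<^sup>2 = 1" by (metis one_power2 power2_abs)
  then show ?thesis
    using that[of "y /\<^sub>R norm y"] True y by (simp add: orthogonal_def)
next
  case False
  define h where "h = v - (u \<bullet> v) *\<^sub>R u"
  have h0: "h \<noteq> 0" using False by (simp add: h_def)
  have uu: "u \<bullet> u = 1" and vv: "v \<bullet> v = 1" using u v by (simp_all add: norm_eq_1)
  have uh: "u \<bullet> h = 0" by (simp add: h_def inner_diff_right uu)
  have "(norm h)\<^sup>2 = 1 - (u \<bullet> v)\<^sup>2"
    unfolding power2_norm_eq_inner
    by (simp add: h_def inner_diff_right inner_diff_left uu vv inner_commute[of v u]
        power2_eq_square)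
  then have nh: "norm h = sqrt (1 - (u \<bullet> v)\<^sup>2)"
    by (metis norm_ge_zero real_sqrt_unique)
  show ?thesis
    by (rule that[of "h /\<^sub>R norm h"]) (use h0 uh nh[symmetric] in \<open>simp_all add: h_def\<close>)
qed

lemma inner_unit_vectors_abs_le:
  fixes u v :: "'a::real_inner"
  assumes "norm u = 1" "norm v = 1"
  shows "\<bar>u \<bullet> v\<bar> \<le> 1"
  using Cauchy_Schwarz_ineq2[of u v] assms by simp

lemma model_geodesic_segment_exists:
  assumes \<kappa>: "\<kappa> > 0" and u: "u \<in> model_surface" and v: "v \<in> model_surface"
  shows "\<exists>G. geodesic_segment model_surface (model_dist \<kappa>) u v G"
proof -
  have nu: "norm u = 1" and nv: "norm v = 1" using u v by (auto simp: model_surface_def)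
  obtain w where w: "norm w = 1" "u \<bullet> w = 0"
      "v = (u \<bullet> v) *\<^sub>R u + sqrt (1 - (u \<bullet> v)\<^sup>2) *\<^sub>R w"
    using unit_vector_in_great_circle[OF nu nv] .
  let ?l = "arccos (u \<bullet> v) / sqrt \<kappa>"
  let ?c = "\<lambda>t. cos (sqrt \<kappa> * t) *\<^sub>R u + sin (sqrt \<kappa> * t) *\<^sub>R w"
  have uv: "\<bar>u \<bullet> v\<bar> \<le> 1" by (rule inner_unit_vectors_abs_le[OF nu nv])
  then have a: "0 \<le> arccos (u \<bullet> v)" "arccos (u \<bullet> v) \<le> pi"
    by (auto intro: arccos_lbound arccos_ubound)
  have kl: "sqrt \<kappa> * ?l = arccos (u \<bullet> v)" using \<kappa> by simp
  have "geodesic_path model_surface (model_dist \<kappa>) ?l ?c"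
    by (rule great_arc_geodesic_path) (use \<kappa> nu w a kl in auto)
  moreover have "?c 0 = u" by simp
  moreover have "?c ?l = v"
    unfolding kl using uv w(3) by (simp add: sin_arccos_abs cos_arccos_abs)
  ultimately show ?thesis unfolding geodesic_segment_def by blast
qed

text \<open>
  Existence of comparison triangles with angular side lengths \<open>a\<close>, \<open>p\<close>, \<open>q\<close>.  The side of length
  \<open>a\<close> is laid on a great circle spanned by \<open>u\<close> and \<open>w\<close>; the two prescribed inner products then fix
  the first two coordinates of \<open>x\<close>.  Room for a third coordinate is exactly
  \<open>cos (p + a) \<le> cos q \<le> cos (p - a)\<close>, which is where the triangle inequalities and the bound on the
  perimeter enter.
\<close>

lemma spherical_triangle_exists:
  fixes a p q :: real
  assumes a: "0 \<le> a" "a < pi" and p: "0 \<le> p" "p \<le> pi" and q: "0 \<le> q" "q \<le> pi"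
    and tri: "q \<le> p + a" "p \<le> q + a" "a \<le> p + q" and per: "a + p + q \<le> 2 * pi"
  obtains u w x :: "real ^ 3" where
    "norm u = 1" "norm w = 1" "u \<bullet> w = 0" "norm x = 1" "x \<bullet> u = cos p"
    "x \<bullet> (cos a *\<^sub>R u + sin a *\<^sub>R w) = cos q"
proof -
  \<comment> \<open>The second coordinate.  For \<open>a = 0\<close> it is unconstrained, and division by zero makes it \<open>0\<close>.\<close>
  define t where "t = (cos q - cos p * cos a) / sin a"
  have up: "cos q \<le> cos p * cos a + sin p * sin a"
  proof -
    have "cos q \<le> cos \<bar>p - a\<bar>" using a p q tri by (intro cos_monotone_0_pi_le) auto
    then show ?thesis by (simp add: cos_diff)
  qed
  have lo: "cos p * cos a - sin p * sin a \<le> cos q"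
  proof (cases "p + a \<le> pi")
    case True
    then have "cos (p + a) \<le> cos q" using a p q tri by (intro cos_monotone_0_pi_le) auto
    then show ?thesis by (simp add: cos_add)
  next
    case False
    then have "cos (2 * pi - (p + a)) \<le> cos q"
      using a p q tri per by (intro cos_monotone_0_pi_le) auto
    then show ?thesis by (simp add: cos_add cos_diff)
  qed
  have t: "t * sin a = cos q - cos p * cos a" and t2: "t\<^sup>2 \<le> (sin p)\<^sup>2"
  proof -
    show "t * sin a = cos q - cos p * cos a"
    proof (cases "a = 0")
      case True then have "p = q" using tri by simp
      then show ?thesis using True by simp
    next
      case False then have "sin a > 0" using a by (intro sin_gt_zero) auto
      then show ?thesis by (simp add: t_def)
    qed
    have "\<bar>t\<bar> \<le> sin p"
    proof (cases "a = 0")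
      case True then show ?thesis using p by (simp add: t_def sin_ge_zero)
    next
      case False then have "sin a > 0" using a by (intro sin_gt_zero) auto
      then show ?thesis using up lo unfolding t_def
        by (simp add: abs_le_iff divide_le_eq minus_le_iff le_divide_eq)
    qed
    then show "t\<^sup>2 \<le> (sin p)\<^sup>2" by (metis abs_ge_zero power2_abs power_mono)
  qed
  define u w x :: "real ^ 3" where "u = vector [1,0,0]" and "w = vector [0,1,0]"
    and "x = vector [cos p, t, sqrt ((sin p)\<^sup>2 - t\<^sup>2)]"
  show ?thesis
  proof (rule that[of u w x])
    show "norm u = 1" "norm w = 1" "u \<bullet> w = 0"
      by (simp_all add: u_def w_def norm_eq_1 inner_vec_def sum_3)
    have "cos p * cos p + (t * t + ((sin p)\<^sup>2 - t\<^sup>2)) = 1"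
      using sin_cos_squared_add[of p] by (simp add: power2_eq_square)
    then show "norm x = 1"
      using t2 by (simp add: x_def norm_eq_1 inner_vec_def sum_3)
    show "x \<bullet> u = cos p"
      by (simp add: x_def u_def inner_vec_def sum_3)
    show "x \<bullet> (cos a *\<^sub>R u + sin a *\<^sub>R w) = cos q"
      using t by (simp add: x_def u_def w_def inner_vec_def sum_3 mult.commute)
  qed
qed

lemma great_arc_midpoint:
  fixes u w :: "'a::real_vector"
  shows "(2 * cos (a / 2)) *\<^sub>R (cos (a / 2) *\<^sub>R u + sin (a / 2) *\<^sub>R w)
           = u + (cos a *\<^sub>R u + sin a *\<^sub>R w)"
proof -
  have "cos a = 2 * (cos (a/2))\<^sup>2 - 1" using cos_double_cos[of "a/2"] by simp
  then have "1 + cos a = 2 * cos (a/2) * cos (a/2)" by (simp add: power2_eq_square)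
  moreover have "sin a = 2 * cos (a/2) * sin (a/2)" using sin_double[of "a/2"] by simp
  moreover have "u + (cos a *\<^sub>R u + sin a *\<^sub>R w) = (1 + cos a) *\<^sub>R u + sin a *\<^sub>R w"
    by (simp add: scaleR_left_distrib)
  ultimately show ?thesis
    by (simp add: scaleR_right_distrib)
qed

section \<open>The midpoint inequality\<close>

lemmas CAT_space_geodesic_exists = CAT_space_def[THEN iffD1, THEN conjunct2, THEN conjunct1, rule_format]

lemmas CAT_space_comparison = CAT_space_def[THEN iffD1, THEN conjunct2, THEN conjunct2, rule_format]

text \<open>
  In the sphere the midpoint of the unit vectors \<open>y\<close>, \<open>z\<close> at angle \<open>l\<close> is \<open>(y + z) / (2 * cos (l / 2))\<close>,
  so that the angle between it and \<open>x\<close> is exactly the arc cosine of \<open>C\<close>.  Comparison turns this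
  identity into an inequality.
\<close>

lemma CAT_space_midpoint_ineq:
  assumes \<kappa>: "\<kappa> > 0" and cat: "CAT_space \<kappa> S d"
    and path: "geodesic_path S d l c" and x: "x \<in> S"
    and l: "l < model_diameter \<kappa>"
    and d0: "d x (c 0) < model_diameter \<kappa>" and dl: "d x (c l) < model_diameter \<kappa>"
    and per: "l + d x (c 0) + d x (c l) < 2 * model_diameter \<kappa>"
  defines "k \<equiv> sqrt \<kappa>"
  defines "C \<equiv> (cos (k * d x (c 0)) + cos (k * d x (c l))) / (2 * cos (k * l / 2))"
  shows "C \<le> 1" and "k * d x (c (l / 2)) \<le> arccos C"
proof -
  have k: "k > 0" using \<kappa> by (simp add: k_def)
  have kD: "k * model_diameter \<kappa> = pi" using k by (simp add: model_diameter_def k_def)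
  interpret Metric_space S d using cat by (simp add: CAT_space_def)
  have l0: "0 \<le> l" using path by (simp add: geodesic_path_def)
  have cS: "c t \<in> S" if "t \<in> {0..l}" for t
    using path that by (auto simp: geodesic_path_def)
  have cd: "d (c s) (c t) = \<bar>s - t\<bar>" if "s \<in> {0..l}" "t \<in> {0..l}" for s t
    using path that by (auto simp: geodesic_path_def)
  let ?y = "c 0" and ?z = "c l"
  have yS: "?y \<in> S" and zS: "?z \<in> S" using cS l0 by auto
  have yz: "d ?y ?z = l" using cd l0 by auto
  have scale: "k * r < pi" if "r < model_diameter \<kappa>" for r
    using mult_strict_left_mono[OF that k] kD by simp
  have "l \<le> d x ?y + d x ?z" "d x ?z \<le> d x ?y + l" "d x ?y \<le> d x ?z + l"
    using triangle[OF yS x zS] triangle[OF x yS zS] triangle[OF x zS yS] yz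
    by (simp_all add: commute)
  then have ktri: "k * l \<le> k * d x ?y + k * d x ?z" "k * d x ?z \<le> k * d x ?y + k * l"
      "k * d x ?y \<le> k * d x ?z + k * l"
    using k by (metis distrib_left mult_left_mono less_imp_le)+
  have kper: "k * l + k * d x ?y + k * d x ?z \<le> 2 * pi"
    using mult_strict_left_mono[OF per k] kD by (simp add: algebra_simps)
  obtain u w x' :: "real ^ 3" where sph: "norm u = 1" "norm w = 1" "u \<bullet> w = 0" "norm x' = 1"
      "x' \<bullet> u = cos (k * d x ?y)"
      "x' \<bullet> (cos (k * l) *\<^sub>R u + sin (k * l) *\<^sub>R w) = cos (k * d x ?z)"
    using spherical_triangle_exists[of "k * l" "k * d x ?y" "k * d x ?z"]
      ktri kper k l0 scale[OF l] scale[OF d0] scale[OF dl] by (auto simp: less_imp_le)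
  define c' where "c' = (\<lambda>t. cos (k * t) *\<^sub>R u + sin (k * t) *\<^sub>R w)"
  have c'path: "geodesic_path model_surface (model_dist \<kappa>) l c'"
    unfolding c'_def k_def
    by (rule great_arc_geodesic_path) (use \<kappa> sph l0 scale[OF l] in \<open>auto simp: k_def\<close>)
  have c'0: "c' 0 = u" by (simp add: c'_def)
  have c'd: "model_dist \<kappa> (c' s) (c' t) = \<bar>s - t\<bar>" if "s \<in> {0..l}" "t \<in> {0..l}" for s t
    using c'path that by (auto simp: geodesic_path_def)
  have c'S: "c' t \<in> model_surface" if "t \<in> {0..l}" for t
    using c'path that by (auto simp: geodesic_path_def)
  have x'S: "x' \<in> model_surface" using sph by (simp add: model_surface_def)
  have xu: "model_dist \<kappa> x' u = d x ?y"
    using k scale[OF d0] sph(5) by (simp add: model_dist_def arccos_cos flip: k_def)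
  have zx: "model_dist \<kappa> (c' l) x' = d ?z x"
    using k scale[OF dl] sph(6)
    by (simp add: model_dist_def arccos_cos c'_def inner_commute commute flip: k_def)
  have xx: "model_dist \<kappa> x' x' = 0"
    using sph(4) by (simp add: model_dist_def norm_eq_1)
  obtain B where B: "geodesic_segment S d ?z x B"
    using CAT_space_geodesic_exists[OF cat zS x] dl by (auto simp: commute)
  obtain D where D: "geodesic_segment S d x ?y D"
    using CAT_space_geodesic_exists[OF cat x yS d0] by blast
  obtain B' where B': "geodesic_segment model_surface (model_dist \<kappa>) (c' l) x' B'"
    using model_geodesic_segment_exists[OF \<kappa> c'S x'S, of l] l0 by auto
  obtain D' where D': "geodesic_segment model_surface (model_dist \<kappa>) x' u D'"
    using model_geodesic_segment_exists[OF \<kappa> x'S c'S, of 0] l0 c'0 by auto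
  have xD: "x \<in> D" using D by (force simp: geodesic_segment_def geodesic_path_def)
  have x'D: "x' \<in> D'" using D' by (force simp: geodesic_segment_def geodesic_path_def)
  have "geodesic_triangle S d ?y ?z x (c ` {0..l}) B D"
    unfolding geodesic_triangle_def using B D path by (auto simp: geodesic_segment_def)
  moreover have "d ?y ?z + d ?z x + d x ?y < 2 * model_diameter \<kappa>"
    using per yz by (simp add: commute)
  moreover have "comparison_triangle \<kappa> d ?y ?z x u (c' l) x' (c' ` {0..l}) B' D'"
    unfolding comparison_triangle_def geodesic_triangle_def
    using B' D' xu zx yz c'path c'0 c'd[of 0 l] l0 by (auto simp: geodesic_segment_def)
  moreover have "comparison_point \<kappa> d ?y ?z x (c ` {0..l}) B D u (c' l) x'
      (c' ` {0..l}) B' D' (c (l/2)) (c' (l/2))"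
    unfolding comparison_point_def using c'd[of 0 "l/2"] cd[of 0 "l/2"] l0 c'0 by auto
  moreover have "comparison_point \<kappa> d ?y ?z x (c ` {0..l}) B D u (c' l) x'
      (c' ` {0..l}) B' D' x x'"
    unfolding comparison_point_def using xD x'D xx x by auto
  ultimately have "d (c (l/2)) x \<le> model_dist \<kappa> (c' (l/2)) x'"
    by (rule CAT_space_comparison[OF cat])
  moreover have C: "c' (l/2) \<bullet> x' = C"
  proof -
    have pos: "cos (k * l / 2) > 0" using k l0 scale[OF l] by (intro cos_gt_zero_pi) (auto intro: less_le_trans[of _ 0])
    have "(2 * cos (k * l / 2)) *\<^sub>R c' (l/2) = u + c' l"
      using great_arc_midpoint[of "k * l" u w] by (simp add: c'_def)
    then have "2 * cos (k * l / 2) * (c' (l/2) \<bullet> x') = (u + c' l) \<bullet> x'"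
      by (metis inner_scaleR_left)
    also have "\<dots> = cos (k * d x ?y) + cos (k * d x ?z)"
      using sph(5,6) by (simp only: c'_def inner_add_right inner_commute[of _ x'])
    finally show ?thesis using pos by (simp add: C_def field_simps)
  qed
  ultimately show "k * d x (c (l/2)) \<le> arccos C"
    using k by (simp add: model_dist_def commute field_simps flip: k_def)
  have "c' (l/2) \<in> model_surface" using c'S l0 by simp
  then show "C \<le> 1"
    using inner_unit_vectors_abs_le[of "c' (l/2)" x'] sph(4) C by (simp add: model_surface_def)
qed

section \<open>The asymptotic radius of a bounded sequence\<close>

text \<open>
  The upper limit of \<open>dist x (s n)\<close>, written as an infimum of eventual upper bounds so that it is a
  real number.
\<close>

definition asymptotic_radius :: "(nat \<Rightarrow> 'a::metric_space) \<Rightarrow> 'a \<Rightarrow> real" where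
  "asymptotic_radius s x = Inf {\<rho>. \<forall>\<^sub>F n in sequentially. dist x (s n) \<le> \<rho>}"

lemma asymptotic_radius_le:
  assumes "\<forall>\<^sub>F n in sequentially. dist x (s n) \<le> \<rho>"
  shows "asymptotic_radius s x \<le> \<rho>"
  unfolding asymptotic_radius_def
proof (rule cInf_lower)
  show "bdd_below {\<rho>. \<forall>\<^sub>F n in sequentially. dist x (s n) \<le> \<rho>}"
  proof (rule bdd_belowI[of _ 0])
    fix \<rho>' assume "\<rho>' \<in> {\<rho>. \<forall>\<^sub>F n in sequentially. dist x (s n) \<le> \<rho>}"
    then obtain n where "dist x (s n) \<le> \<rho>'" by (auto simp: eventually_sequentially)
    then show "0 \<le> \<rho>'" using zero_le_dist[of x "s n"] by linarith
  qed
qed (use assms in auto)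

context
  fixes s :: "nat \<Rightarrow> 'a::metric_space"
  assumes bounded: "bounded (range s)"
begin

lemma asymptotic_radius_set_nonempty: "{\<rho>. \<forall>\<^sub>F n in sequentially. dist x (s n) \<le> \<rho>} \<noteq> {}"
proof -
  obtain e where "\<forall>y\<in>range s. dist x y \<le> e"
    using bounded bounded_any_center[of "range s" x] by blast
  then show ?thesis by (auto intro!: exI[of _ e])
qed

lemma eventually_dist_less:
  assumes "asymptotic_radius s x < \<rho>"
  shows "\<forall>\<^sub>F n in sequentially. dist x (s n) < \<rho>"
proof -
  obtain r where "r < \<rho>" "\<forall>\<^sub>F n in sequentially. dist x (s n) \<le> r"
    using cInf_lessD[OF asymptotic_radius_set_nonempty[of x], of \<rho>] assms
    unfolding asymptotic_radius_def by blast
  then show ?thesis by (auto elim!: eventually_mono)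
qed

lemma asymptotic_radius_nonneg: "0 \<le> asymptotic_radius s x"
proof (rule ccontr)
  assume "\<not> ?thesis"
  then have "\<forall>\<^sub>F n in sequentially. dist x (s n) < 0" by (intro eventually_dist_less) simp
  then show False by (simp add: not_less eventually_False)
qed

lemma asymptotic_radius_le_add_dist:
  "asymptotic_radius s x \<le> asymptotic_radius s y + dist x y"
proof (rule field_le_epsilon)
  fix e :: real assume "0 < e"
  then have "\<forall>\<^sub>F n in sequentially. dist y (s n) < asymptotic_radius s y + e"
    by (intro eventually_dist_less) simp
  then have "\<forall>\<^sub>F n in sequentially. dist x (s n) \<le> asymptotic_radius s y + dist x y + e"
    by eventually_elim (use dist_triangle in \<open>smt (verit)\<close>)
  then show "asymptotic_radius s x \<le> asymptotic_radius s y + dist x y + e"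
    by (rule asymptotic_radius_le)
qed

text \<open>
  With \<open>P\<close> the upper limit of \<open>dist u (s n)\<close>, taking upper limits on both sides gives
  \<open>\<alpha> * P\<^sup>2 \<le> (\<alpha> - 1) * P\<^sup>2 + \<rho>\<^sup>2\<close>, that is \<open>P \<le> \<rho>\<close>.  The index maps \<open>i\<close> and \<open>j\<close> let
  the lemma be used both with the term \<open>n\<close> bounded by its successor and conversely; \<open>i\<close> must not
  lose any tail of the sequence.
\<close>

lemma asymptotic_radius_contraction:
  fixes i j :: "nat \<Rightarrow> nat"
  assumes j: "filterlim j sequentially sequentially"
    and i: "\<And>P. (\<forall>\<^sub>F n in sequentially. P (i n)) \<Longrightarrow> (\<forall>\<^sub>F n in sequentially. P n)"
    and "\<alpha> \<ge> 1" and \<rho>: "0 \<le> \<rho>"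
    and ev: "\<forall>\<^sub>F n in sequentially.
      \<alpha> * (dist u (s (i n)))\<^sup>2 \<le> (\<alpha> - 1) * (dist u (s (j n)))\<^sup>2 + \<rho>\<^sup>2"
  shows "asymptotic_radius s u \<le> \<rho>"
proof -
  let ?P = "asymptotic_radius s u"
  have *: "\<alpha> * ?P\<^sup>2 \<le> (\<alpha> - 1) * (?P + e)\<^sup>2 + \<rho>\<^sup>2" if "e > 0" for e
  proof -
    let ?q = "((\<alpha> - 1) * (?P + e)\<^sup>2 + \<rho>\<^sup>2) / \<alpha>"
    have "\<forall>\<^sub>F n in sequentially. dist u (s n) < ?P + e"
      by (intro eventually_dist_less) (use that in simp)
    then have "\<forall>\<^sub>F n in sequentially. dist u (s (j n)) < ?P + e"
      using j by (rule eventually_compose_filterlim)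
    then have "\<forall>\<^sub>F n in sequentially. dist u (s (i n)) \<le> sqrt ?q"
      using ev
    proof eventually_elim
      case (elim n)
      have "(dist u (s (j n)))\<^sup>2 \<le> (?P + e)\<^sup>2" using elim(1) by (intro power_mono) auto
      then have "(\<alpha> - 1) * (dist u (s (j n)))\<^sup>2 \<le> (\<alpha> - 1) * (?P + e)\<^sup>2"
        using \<open>\<alpha> \<ge> 1\<close> by (intro mult_left_mono) auto
      then have "(dist u (s (i n)))\<^sup>2 \<le> ?q"
        using elim(2) \<open>\<alpha> \<ge> 1\<close> by (simp add: field_simps)
      then show ?case by (rule real_le_rsqrt)
    qed
    then have "\<forall>\<^sub>F n in sequentially. dist u (s n) \<le> sqrt ?q" by (rule i)
    then have "?P \<le> sqrt ?q" by (rule asymptotic_radius_le)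
    then have "?P\<^sup>2 \<le> (sqrt ?q)\<^sup>2" using asymptotic_radius_nonneg by (intro power_mono) auto
    also have "\<dots> = ?q" using \<open>\<alpha> \<ge> 1\<close> by (intro real_sqrt_pow2) auto
    finally show ?thesis using \<open>\<alpha> \<ge> 1\<close> by (simp add: field_simps)
  qed
  have "((\<lambda>e. (\<alpha> - 1) * (?P + e)\<^sup>2 + \<rho>\<^sup>2) \<longlongrightarrow> (\<alpha> - 1) * (?P + 0)\<^sup>2 + \<rho>\<^sup>2) (at_right 0)"
    by (intro tendsto_intros)
  then have "\<alpha> * ?P\<^sup>2 \<le> (\<alpha> - 1) * (?P + 0)\<^sup>2 + \<rho>\<^sup>2"
    by (rule tendsto_lowerbound) (auto intro!: eventually_at_rightI[of 0 1] *)
  then have "?P\<^sup>2 \<le> \<rho>\<^sup>2" by (simp add: algebra_simps)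
  then show ?thesis using \<rho> by (rule power2_le_imp_le)
qed

end

section \<open>The asymptotic center\<close>

text \<open>
  Let \<open>k = sqrt \<kappa>\<close> and let \<open>\<epsilon>\<close> be small.  If \<open>y\<close> and \<open>z\<close> have asymptotic radius less than \<open>R + \<delta>\<close>
  and distance at least \<open>\<epsilon>\<close>, and \<open>\<rho>\<close> is the asymptotic radius of their midpoint, then the
  midpoint inequality gives \<open>cos (k * \<rho>) \<ge> cos (k * (R + \<delta>)) / cos (k * \<epsilon> / 2)\<close>.  Since
  \<open>cos (k * R) > 0\<close>, the right-hand side exceeds \<open>cos (k * R)\<close> for small \<open>\<delta>\<close>, which contradicts
  \<open>R \<le> \<rho>\<close>.
\<close>

lemma CAT_space_almost_centers_close:
  fixes K :: "'a::metric_space set"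
  assumes \<kappa>: "\<kappa> > 0" and cat: "CAT_space \<kappa> (UNIV :: 'a set) dist"
    and conv: "geodesically_convex UNIV dist K"
    and s: "bounded (range s)"
    and R: "0 \<le> R" "R < pi / (2 * sqrt \<kappa>)"
    and R_le: "\<And>x. x \<in> K \<Longrightarrow> R \<le> asymptotic_radius s x"
    and \<epsilon>: "\<epsilon> > 0"
  obtains \<delta> where "\<delta> > 0"
    "\<And>y z. y \<in> K \<Longrightarrow> z \<in> K \<Longrightarrow> asymptotic_radius s y < R + \<delta> \<Longrightarrow>
       asymptotic_radius s z < R + \<delta> \<Longrightarrow> dist y z < \<epsilon>"
proof -
  define k where "k = sqrt \<kappa>"
  have k: "k > 0" using \<kappa> by (simp add: k_def)
  have D: "model_diameter \<kappa> = pi / k" by (simp add: model_diameter_def k_def)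
  have kR: "0 \<le> k * R" "k * R < pi / 2" using R k by (simp_all add: k_def field_simps)
  \<comment> \<open>Shrinking \<open>\<epsilon>\<close> keeps \<open>k * \<epsilon>' / 2\<close> in the range where the cosine is positive and decreasing.\<close>
  define \<epsilon>' where "\<epsilon>' = min \<epsilon> (1 / k)"
  have \<epsilon>': "0 < \<epsilon>'" "\<epsilon>' \<le> \<epsilon>" "k * \<epsilon>' \<le> 1" using \<epsilon> k by (auto simp: \<epsilon>'_def min_def field_simps)
  have ke: "0 < k * \<epsilon>' / 2" "k * \<epsilon>' / 2 < pi / 2" using \<epsilon>' k pi_gt3 by auto
  have cose: "0 < cos (k * \<epsilon>' / 2)" using ke by (intro cos_gt_zero_pi) auto
  have "cos (k * \<epsilon>' / 2) < cos 0" using ke by (intro cos_monotone_0_pi) auto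
  moreover have "cos (k * R) > 0" using kR by (intro cos_gt_zero_pi) auto
  ultimately have gap: "cos (k * R) * cos (k * \<epsilon>' / 2) < cos (k * R)" by simp
  have "((\<lambda>\<delta>. cos (k * (R + \<delta>))) \<longlongrightarrow> cos (k * (R + 0))) (at_right 0)"
    by (intro tendsto_intros)
  then have "\<forall>\<^sub>F \<delta> in at_right 0. cos (k * R) * cos (k * \<epsilon>' / 2) < cos (k * (R + \<delta>))"
    by (rule order_tendstoD) (use gap in simp)
  moreover have "((\<lambda>\<delta>. k * (R + \<delta>)) \<longlongrightarrow> k * (R + 0)) (at_right 0)"
    by (intro tendsto_intros)
  then have "\<forall>\<^sub>F \<delta> in at_right 0. k * (R + \<delta>) < pi / 2"
    by (rule order_tendstoD) (use kR in simp)
  moreover have "\<forall>\<^sub>F \<delta> in at_right (0::real). 0 < \<delta>" by (simp add: eventually_at_right_less)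
  ultimately have "\<forall>\<^sub>F \<delta> in at_right 0. 0 < \<delta> \<and> k * (R + \<delta>) < pi / 2 \<and>
      cos (k * R) * cos (k * \<epsilon>' / 2) < cos (k * (R + \<delta>))"
    by eventually_elim auto
  then obtain \<delta> where \<delta>: "0 < \<delta>" "k * (R + \<delta>) < pi / 2"
      "cos (k * R) * cos (k * \<epsilon>' / 2) < cos (k * (R + \<delta>))"
    using eventually_happens trivial_limit_at_right_real by blast
  show ?thesis
  proof (rule that[of \<delta>])
    fix y z assume yz: "y \<in> K" "z \<in> K"
      and ry: "asymptotic_radius s y < R + \<delta>" and rz: "asymptotic_radius s z < R + \<delta>"
    have ev: "\<forall>\<^sub>F n in sequentially. dist y (s n) < R + \<delta> \<and> dist z (s n) < R + \<delta>"
      by (intro eventually_conj eventually_dist_less s ry rz)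
    have R\<delta>: "R + \<delta> < pi / (2 * k)" using \<delta>(2) k by (simp add: field_simps)
    then have R\<delta>2: "2 * (R + \<delta>) < pi / k" using k by (simp add: field_simps)
    obtain N where "dist y (s N) < R + \<delta>" "dist z (s N) < R + \<delta>"
      using ev eventually_happens by force
    then have dyz: "dist y z < pi / k"
      using dist_triangle2[of y z "s N"] R\<delta>2 by (smt (verit))
    show "dist y z < \<epsilon>"
    proof (rule ccontr)
      assume "\<not> dist y z < \<epsilon>"
      then have far: "\<epsilon>' \<le> dist y z" using \<epsilon>' by linarith
      obtain G where G: "geodesic_segment UNIV dist y z G"
        using CAT_space_geodesic_exists[OF cat] dyz D by auto
      then obtain l c where c: "geodesic_path UNIV dist l c" "c 0 = y" "c l = z" "G = c ` {0..l}"
        by (auto simp: geodesic_segment_def)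
      have l0: "0 \<le> l" using c by (simp add: geodesic_path_def)
      have l: "l = dist y z" using c l0 by (force simp: geodesic_path_def)
      let ?m = "c (l/2)"
      have "G \<subseteq> K" using conv G yz by (auto simp: geodesically_convex_def)
      then have m: "?m \<in> K" using c l0 by auto
      let ?C = "cos (k * (R + \<delta>)) / cos (k * \<epsilon>' / 2)"
      have cosR\<delta>: "0 < cos (k * (R + \<delta>))"
        using \<delta> R k by (intro cos_gt_zero_pi) (auto intro: less_le_trans[of _ 0])
      have kl: "k * l < pi" "k * \<epsilon>' \<le> k * l" using dyz k l far by (auto simp: field_simps)
      have cosl: "0 < cos (k * l / 2)" "cos (k * l / 2) \<le> cos (k * \<epsilon>' / 2)"
        using kl ke by (auto intro!: cos_gt_zero_pi cos_monotone_0_pi_le)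
      have midC: "?C \<le> 1 \<and> k * dist ?m (s n) \<le> arccos ?C"
        if n: "dist y (s n) < R + \<delta> \<and> dist z (s n) < R + \<delta>" for n
      proof -
        let ?C' = "(cos (k * dist (s n) (c 0)) + cos (k * dist (s n) (c l))) / (2 * cos (k * l / 2))"
        have dn: "dist (s n) (c 0) < R + \<delta>" "dist (s n) (c l) < R + \<delta>"
          using n c by (auto simp: dist_commute)
        have small: "R + \<delta> < pi / k" using R\<delta>2 R(1) \<delta>(1) by (smt (verit))
        have mid: "?C' \<le> 1" "k * dist (s n) ?m \<le> arccos ?C'"
          using CAT_space_midpoint_ineq[OF \<kappa> cat c(1), of "s n"] dn small R\<delta>2 dyz l D
          by (auto simp: k_def)
        have mono: "cos (k * (R + \<delta>)) \<le> cos (k * r)" if "0 \<le> r" "r < R + \<delta>" for r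
          proof (rule cos_monotone_0_pi_le)
          show "k * (R + \<delta>) \<le> pi" using \<delta>(2) pi_gt_zero by linarith
        qed (use that k in auto)
        have "cos (k * (R + \<delta>)) / cos (k * \<epsilon>' / 2) \<le> cos (k * (R + \<delta>)) / cos (k * l / 2)"
          using cosR\<delta> cosl by (intro divide_left_mono) auto
        also have "\<dots> = (2 * cos (k * (R + \<delta>))) / (2 * cos (k * l / 2))" by simp
        also have "\<dots> \<le> ?C'"
          using mono[OF _ dn(1)] mono[OF _ dn(2)] cosl by (intro divide_right_mono) auto
        finally have le: "?C \<le> ?C'" .
        have "0 \<le> ?C" using cosR\<delta> cose by simp
        then have "arccos ?C' \<le> arccos ?C"
          using mid(1) le by (intro arccos_le_arccos) auto
        then show ?thesis using mid le by (simp add: dist_commute)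
      qed
      obtain N where "dist y (s N) < R + \<delta> \<and> dist z (s N) < R + \<delta>"
        using ev eventually_happens by force
      then have C1: "?C \<le> 1" using midC by blast
      have C0: "0 \<le> ?C" using cosR\<delta> cose by simp
      have "\<forall>\<^sub>F n in sequentially. dist ?m (s n) \<le> arccos ?C / k"
        using ev by eventually_elim (use midC k in \<open>simp add: field_simps\<close>)
      then have "asymptotic_radius s ?m \<le> arccos ?C / k" by (rule asymptotic_radius_le)
      then have "R \<le> arccos ?C / k" using R_le[OF m] by (rule order_trans[rotated])
      then have "k * R \<le> arccos ?C" using k by (simp only: pos_le_divide_eq mult.commute[of k R])
      then have "cos (arccos ?C) \<le> cos (k * R)"
        using kR C0 C1 by (intro cos_monotone_0_pi_le arccos_ubound) auto
      then have "?C \<le> cos (k * R)" using C0 C1 by (simp add: cos_arccos)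
      then show False using \<delta>(3) cose by (simp add: field_simps)
    qed
  qed (use \<delta> in auto)
qed

text \<open>
  Closeness of almost minimisers gives both halves: minimising sequences are Cauchy, and two
  minimisers have arbitrarily small distance.  The limit is again a minimiser because the
  asymptotic radius is 1-Lipschitz.
\<close>

lemma CAT_space_asymptotic_center:
  fixes K :: "'a::complete_space set"
  assumes \<kappa>: "\<kappa> > 0" and cat: "CAT_space \<kappa> (UNIV :: 'a set) dist"
    and closed: "closed K" and conv: "geodesically_convex UNIV dist K"
    and s: "bounded (range s)"
    and x0: "x0 \<in> K" "asymptotic_radius s x0 < pi / (2 * sqrt \<kappa>)"
  obtains z where "z \<in> K"
    "\<And>y. y \<in> K \<Longrightarrow> asymptotic_radius s y \<le> asymptotic_radius s z \<Longrightarrow> y = z"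
proof -
  let ?r = "asymptotic_radius s"
  define R where "R = Inf (?r ` K)"
  have bdd: "bdd_below (?r ` K)"
    using asymptotic_radius_nonneg[OF s] by (auto intro: bdd_belowI[of _ 0])
  have R_le: "R \<le> ?r x" if "x \<in> K" for x
    unfolding R_def using that bdd by (intro cInf_lower) auto
  have R0: "0 \<le> R"
    unfolding R_def using x0 asymptotic_radius_nonneg[OF s] by (intro cInf_greatest) auto
  have R1: "R < pi / (2 * sqrt \<kappa>)" using R_le[OF x0(1)] x0(2) by linarith
  have close: "\<exists>\<delta>>0. \<forall>y\<in>K. \<forall>z\<in>K. ?r y < R + \<delta> \<longrightarrow> ?r z < R + \<delta> \<longrightarrow> dist y z < \<epsilon>"
    if "\<epsilon> > 0" for \<epsilon>
    using CAT_space_almost_centers_close[OF \<kappa> cat conv s R0 R1 R_le that] by metis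
  have "\<exists>y\<in>K. ?r y < R + inverse (real (Suc n))" for n
    using cInf_lessD[of "?r ` K" "R + inverse (real (Suc n))"] x0 by (auto simp: R_def)
  then obtain y where y: "\<And>n. y n \<in> K" "\<And>n. ?r (y n) < R + inverse (real (Suc n))"
    by metis
  have y_ev: "\<exists>N. \<forall>n\<ge>N. ?r (y n) < R + \<delta>" if \<delta>: "\<delta> > 0" for \<delta> :: real
  proof -
    obtain N where N: "inverse (real (Suc N)) < \<delta>" using reals_Archimedean[OF \<delta>] by blast
    have "?r (y n) < R + \<delta>" if "n \<ge> N" for n
    proof -
      have "inverse (real (Suc n)) \<le> inverse (real (Suc N))" using that by simp
      then show ?thesis using y(2)[of n] N by linarith
    qed
    then show ?thesis by blast
  qed
  have "Cauchy y"
  proof (rule metric_CauchyI)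
    fix \<epsilon> :: real assume "0 < \<epsilon>"
    then show "\<exists>M. \<forall>m\<ge>M. \<forall>n\<ge>M. dist (y m) (y n) < \<epsilon>"
      using close y(1) y_ev by meson
  qed
  then obtain z where z: "y \<longlonglongrightarrow> z" using Cauchy_convergent convergent_def by blast
  have zK: "z \<in> K" using closed_sequentially[OF closed y(1) z] .
  have "(\<lambda>n. R + inverse (real (Suc n)) + dist z (y n)) \<longlonglongrightarrow> R + 0 + dist z z"
    by (intro tendsto_intros z LIMSEQ_inverse_real_of_nat)
  then have rz: "?r z \<le> R"
    using tendsto_lowerbound[of _ "R + 0 + dist z z" sequentially "?r z"]
      asymptotic_radius_le_add_dist[OF s, of z] y(2)
    by (smt (verit) always_eventually dist_self trivial_limit_sequentially)
  show ?thesis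
  proof (rule that[OF zK])
    fix v assume v: "v \<in> K" "?r v \<le> ?r z"
    have "dist v z < \<epsilon>" if "\<epsilon> > 0" for \<epsilon>
      using close[OF that] v zK rz by (smt (verit))
    then show "v = z" by (metis dist_pos_lt less_irrefl)
  qed
qed

section \<open>Hybrid mappings\<close>

text \<open>
  For large \<open>n\<close> the right-hand side of the hybrid inequality at the pair \<open>z\<close>, \<open>s n\<close> is at most
  \<open>\<rho>\<^sup>2\<close>, with \<open>\<rho>\<close> slightly above the asymptotic radius of \<open>z\<close>, because \<open>b1 z + b2 z \<le> 1\<close>.
  Since \<open>a1 z\<close> and \<open>a2 z\<close> avoid the interval \<open>{0<..<1}\<close> and have sum at least \<open>1\<close>, one of them, \<open>\<alpha>\<close>, is at
  least \<open>1\<close> while the other is at least \<open>1 - \<alpha>\<close>; moving the latter term to the right produces the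
  hypothesis of \<open>asymptotic_radius_contraction\<close>.
\<close>

lemma hybrid_orbit_asymptotic_radius_le:
  assumes hyb: "multivalued_hybrid_I K T a1 a2 b1 b2"
    and sK: "\<And>n. s n \<in> K" and sT: "\<And>n. s (Suc n) \<in> T (s n)" and s: "bounded (range s)"
    and z: "z \<in> K" and u: "u \<in> T z"
  shows "asymptotic_radius s u \<le> asymptotic_radius s z"
proof (rule field_le_epsilon)
  fix e :: real assume e: "0 < e"
  let ?\<rho> = "asymptotic_radius s z + e"
  let ?p = "\<lambda>n. (dist u (s n))\<^sup>2"
  have \<rho>0: "0 \<le> ?\<rho>" using asymptotic_radius_nonneg[OF s, of z] e by simp
  have b: "0 \<le> b1 z" "0 \<le> b2 z" "b1 z + b2 z \<le> 1" "a1 z + a2 z \<ge> 1"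
    and a: "a1 z \<le> 0 \<or> 1 \<le> a1 z" "a2 z \<le> 0 \<or> 1 \<le> a2 z"
    using hyb z by (auto simp: multivalued_hybrid_I_def Pi_iff not_less)
  have "\<forall>\<^sub>F n in sequentially. dist z (s n) < ?\<rho>"
    by (intro eventually_dist_less s) (use e in simp)
  moreover from this have "\<forall>\<^sub>F n in sequentially. dist z (s (Suc n)) < ?\<rho>"
    using filterlim_Suc by (rule eventually_compose_filterlim)
  ultimately have ev: "\<forall>\<^sub>F n in sequentially. a1 z * ?p (Suc n) + a2 z * ?p n \<le> ?\<rho>\<^sup>2"
  proof eventually_elim
    case (elim n)
    have "a1 z * ?p (Suc n) + a2 z * ?p n
        \<le> b1 z * (dist z (s (Suc n)))\<^sup>2 + b2 z * (dist z (s n))\<^sup>2"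
      using hyb z u sK sT by (auto simp: multivalued_hybrid_I_def)
    also have "\<dots> \<le> b1 z * ?\<rho>\<^sup>2 + b2 z * ?\<rho>\<^sup>2"
      using elim b by (intro add_mono mult_left_mono power_mono) auto
    also have "\<dots> = (b1 z + b2 z) * ?\<rho>\<^sup>2" by (simp add: distrib_right)
    also have "\<dots> \<le> ?\<rho>\<^sup>2" using b by (intro mult_left_le_one_le) auto
    finally show ?case .
  qed
  consider "a1 z \<ge> 1" | "a1 z \<le> 0" "a2 z \<ge> 1" using a b by linarith
  then show "asymptotic_radius s u \<le> ?\<rho>"
  proof cases
    case 1
    have "\<forall>\<^sub>F n in sequentially. a1 z * ?p (Suc n) \<le> (a1 z - 1) * ?p n + ?\<rho>\<^sup>2"
      using ev
    proof eventually_elim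
      case (elim n)
      have "(1 - a1 z) * ?p n \<le> a2 z * ?p n" using b by (intro mult_right_mono) auto
      then show ?case using elim by (simp add: algebra_simps)
    qed
    then show ?thesis
      by (intro asymptotic_radius_contraction[OF s, of "\<lambda>n. n" Suc "a1 z"])
        (use 1 \<rho>0 in \<open>auto simp: filterlim_ident eventually_sequentially_Suc\<close>)
  next
    case 2
    have "\<forall>\<^sub>F n in sequentially. a2 z * ?p n \<le> (a2 z - 1) * ?p (Suc n) + ?\<rho>\<^sup>2"
      using ev
    proof eventually_elim
      case (elim n)
      have "(1 - a2 z) * ?p (Suc n) \<le> a1 z * ?p (Suc n)" using b by (intro mult_right_mono) auto
      then show ?case using elim by (simp add: algebra_simps)
    qed
    then show ?thesis
      by (intro asymptotic_radius_contraction[OF s, of Suc "\<lambda>n. n" "a2 z"])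
        (use 2 \<rho>0 in \<open>auto simp: filterlim_Suc\<close>)
  qed
qed

lemma rad_less_imp_ball:
  assumes "rad K < ereal \<rho>"
  obtains x r where "x \<in> K" "r < \<rho>" "\<And>y. y \<in> K \<Longrightarrow> dist x y \<le> r"
proof -
  obtain x where x: "x \<in> K" "(SUP y\<in>K. ereal (dist x y)) < ereal \<rho>"
    using assms by (auto simp: rad_def INF_less_iff)
  obtain r where r: "(SUP y\<in>K. ereal (dist x y)) < ereal r" "r < \<rho>"
    using ereal_dense2[OF x(2)] by auto
  have "dist x y \<le> r" if "y \<in> K" for y
  proof -
    have "ereal (dist x y) \<le> (SUP y\<in>K. ereal (dist x y))" using that by (rule SUP_upper)
    also have "\<dots> < ereal r" by (rule r)
    finally show ?thesis by simp
  qed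
  then show ?thesis using that x r by blast
qed

theorem theorem3p5:
  fixes \<kappa> :: real
    and K :: "'a::complete_space set"
    and T :: "'a \<Rightarrow> 'a set"
    and a1 a2 b1 b2 :: "'a \<Rightarrow> real"
  assumes "\<kappa> > 0"
    and "CAT_space \<kappa> (UNIV :: 'a set) dist"
    and "K \<noteq> {}" and "closed K"
    and "geodesically_convex UNIV dist K"
    and "rad K < ereal (pi / (2 * sqrt \<kappa>))"
    and "T \<in> K \<rightarrow> compact_subsets K"
    and "multivalued_hybrid_I K T a1 a2 b1 b2"
  shows "fixed_points K T \<noteq> {}"
proof -
  obtain x0 r where x0: "x0 \<in> K" and r: "r < pi / (2 * sqrt \<kappa>)"
      and ball: "\<And>y. y \<in> K \<Longrightarrow> dist x0 y \<le> r"
    using rad_less_imp_ball[OF assms(6)] by blast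
  have T: "T x \<noteq> {}" "T x \<subseteq> K" if "x \<in> K" for x
    using assms(7) that by (auto simp: compact_subsets_def Pi_iff)
  have "\<exists>y. y \<in> K \<and> y \<in> T x" if "x \<in> K" for x using T[OF that] by blast
  then obtain s where s: "\<And>n. s n \<in> K" "\<And>n. s (Suc n) \<in> T (s n)"
    using dependent_nat_choice[of "\<lambda>_ x. x \<in> K" "\<lambda>_ x y. y \<in> T x"] x0 by blast
  have bounded: "bounded (range s)"
    using ball s(1) by (auto simp: bounded_def)
  have "asymptotic_radius s x0 \<le> r"
    by (rule asymptotic_radius_le) (use ball s(1) in simp)
  then have "asymptotic_radius s x0 < pi / (2 * sqrt \<kappa>)" using r by linarith
  then obtain z where z: "z \<in> K"
      "\<And>y. y \<in> K \<Longrightarrow> asymptotic_radius s y \<le> asymptotic_radius s z \<Longrightarrow> y = z"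
    using CAT_space_asymptotic_center[OF assms(1,2,4,5) bounded x0] by blast
  obtain u where u: "u \<in> T z" using T z(1) by blast
  have "u = z"
    using z(2) hybrid_orbit_asymptotic_radius_le[OF assms(8) s bounded z(1) u] T(2)[OF z(1)] u
    by blast
  then show ?thesis using u z(1) by (auto simp: fixed_points_def)
qed

end
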